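(* Let $a>0$ and $b>0$ be real constants. Let $A:[0,\infty)\to\mathbb{R}$ be a strictly positive, strictly increasing function of class $C^1$ such that $\lim_{t\to\infty}A(t)=\infty$, and let $$f(t)=A(t)\sin\left(\int_0^t A(s)\,ds\right),\quad t\ge 0.$$ Let $\xi_0,\xi_1\in\mathbb{R}$ and let $x$ be the solution of $$x''(t)+ax'(t)+bx(t)=f(t),\quad t\ge 0;\qquad x(0)=\xi_0,\ x'(0)=\xi_1.$$ Then $x''(t)=f(t)+O(1)$ as $t\to\infty$, and $$\limsup_{t\to\infty}|x''(t)|=+\infty,\qquad \limsup_{t\to\infty}|x'(t)|\in(0,\infty),\qquad \lim_{t\to\infty}x(t)=0.$$ *)

theory Defs
  imports "HOL-Analysis.Analysis" "HOL-Library.Landau_Symbols"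
begin

(* Derivatives are taken within {0..}: one-sided at 0, two-sided at every t > 0, so values at
   negative arguments are irrelevant.  The library's C1_differentiable_on would use the two-sided
   derivative at 0 and thereby constrain the functions to the left of 0. *)

definition has_derivative_halfline :: "(real \<Rightarrow> real) \<Rightarrow> (real \<Rightarrow> real) \<Rightarrow> bool" where
  "has_derivative_halfline g g' \<longleftrightarrow>
     (\<forall>t\<ge>0. (g has_real_derivative g' t) (at t within {0..}))"

definition C1_halfline :: "(real \<Rightarrow> real) \<Rightarrow> bool" where
  "C1_halfline g \<longleftrightarrow> (\<exists>g'. has_derivative_halfline g g' \<and> continuous_on {0..} g')"

end

theory Submission
  imports Defs
begin

text \<open>
  Write \<open>I\<close> for the integral of \<open>A\<close>. The forcing \<open>A sin I\<close> is the derivative of \<open>- cos I\<close>. Since \<open>1 / A\<close>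
  decreases to \<open>0\<close>, integration by parts shows that the improper integral of \<open>cos I\<close> converges,
  so \<open>cos I\<close> has a primitive \<open>C\<close> that vanishes at infinity. In the variables \<open>w = x + C\<close> and
  \<open>p = x' + cos I - a C\<close> the equation becomes a stable linear system whose forcing is a multiple of
  \<open>C\<close>, so \<open>w\<close> and \<open>p\<close> tend to \<open>0\<close>. Hence \<open>x\<close> tends to \<open>0\<close>, \<open>x' = - cos I + o(1)\<close> and
  \<open>x'' = f - a x' - b x = f + O(1)\<close>.
\<close>

section \<open>Calculus on the half-line\<close>

lemma has_derivative_halflineD:
  assumes "has_derivative_halfline g g'" "t > 0"
  shows "(g has_real_derivative g' t) (at t)"
proof -
  have "t \<in> interior {0::real..}" using assms(2) by simp
  then have "at t within {0..} = at t" by (rule at_within_interior)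
  with assms show ?thesis unfolding has_derivative_halfline_def by (metis less_imp_le)
qed

lemma has_derivative_halfline_continuous_on:
  assumes "has_derivative_halfline g g'"
  shows "continuous_on {0..} g"
  using assms unfolding has_derivative_halfline_def continuous_on_eq_continuous_within
  by (auto intro: DERIV_continuous)

lemma has_derivative_halfline_integral:
  assumes "continuous_on {0..} g"
  shows "has_derivative_halfline (\<lambda>u. integral {0..u} g) g"
  unfolding has_derivative_halfline_def
proof (intro allI impI)
  fix t :: real assume t: "t \<ge> 0"
  have "continuous_on {0..t+1} g"
    using assms by (rule continuous_on_subset) auto
  then have "((\<lambda>u. integral {0..u} g) has_real_derivative g t) (at t within {0..t+1})"
    by (rule integral_has_real_derivative) (use t in auto)
  \<comment> \<open>The extra unit keeps \<open>t\<close> away from the right endpoint, so the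
    derivative given by the fundamental theorem on the compact interval is also the one within the
    half-line, including the one-sided case at 0.\<close>
  moreover have "at t within {0..t+1} = at t within {0..}"
    by (rule at_within_nhd[where S = "{..<t+1}"]) (use t in auto)
  ultimately show "((\<lambda>u. integral {0..u} g) has_real_derivative g t) (at t within {0..})"
    by simp
qed

section \<open>Convergence of the oscillatory integral of \<open>cos I\<close>\<close>

lemma bounded_increasing_convergent_at_top:
  fixes g :: "real \<Rightarrow> real"
  assumes mono: "\<And>s t. T \<le> s \<Longrightarrow> s \<le> t \<Longrightarrow> g s \<le> g t"
    and bound: "\<And>t. T \<le> t \<Longrightarrow> g t \<le> B"
  obtains L where "(g \<longlongrightarrow> L) at_top"
proof
  have bdd: "bdd_above (g ` {T..})" using bound by (auto intro!: bdd_aboveI)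
  show "(g \<longlongrightarrow> Sup (g ` {T..})) at_top"
  proof (rule increasing_tendsto)
    show "\<forall>\<^sub>F t in at_top. g t \<le> Sup (g ` {T..})"
      using eventually_ge_at_top[of T]
      by eventually_elim (auto intro!: cSup_upper bdd)
  next
    fix y assume "y < Sup (g ` {T..})"
    then obtain s where s: "s \<ge> T" "y < g s"
      using less_cSup_iff[OF _ bdd] by auto
    show "\<forall>\<^sub>F t in at_top. y < g t"
      using eventually_ge_at_top[of s]
      by eventually_elim (use s mono in \<open>auto intro: less_le_trans\<close>)
  qed
qed

text \<open>Integration by parts replaces \<open>D\<close> by \<open>H\<close>, whose derivative is
  bounded in absolute value by \<open>A' / A\<^sup>2\<close>, the derivative of
  \<open>- 1 / A\<close>. Hence \<open>H - 1 / A\<close> increases while \<open>H + 1 / A\<close>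
  decreases; this squeeze forces \<open>H\<close>, and with it \<open>D\<close>, to converge.
  Subtracting the limit from \<open>D\<close> gives \<open>C\<close>.\<close>

lemma vanishing_primitive_cos:
  fixes A I :: "real \<Rightarrow> real"
  assumes I: "\<And>t. t > 0 \<Longrightarrow> (I has_real_derivative A t) (at t)"
    and A: "\<And>t. t > 0 \<Longrightarrow> (A has_real_derivative A' t) (at t)"
    and Apos: "\<And>t. t > 0 \<Longrightarrow> A t > 0"
    and A'nonneg: "\<And>t. t > 0 \<Longrightarrow> A' t \<ge> 0"
    and Alim: "filterlim A at_top at_top"
    and D: "\<And>t. t > 0 \<Longrightarrow> (D has_real_derivative cos (I t)) (at t)"
  obtains C where "\<And>t. t > 0 \<Longrightarrow> (C has_real_derivative cos (I t)) (at t)"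
    and "(C \<longlongrightarrow> 0) at_top"
proof -
  define H where "H t = D t - sin (I t) / A t" for t
  have dH: "(H has_real_derivative sin (I t) * A' t / (A t)\<^sup>2) (at t)" if "t > 0" for t
    unfolding H_def
    using Apos[OF that]
    by (auto intro!: derivative_eq_intros I[OF that] A[OF that] D[OF that]
        simp: field_simps power2_eq_square)
  have dinv: "((\<lambda>t. 1 / A t) has_real_derivative - A' t / (A t)\<^sup>2) (at t)" if "t > 0" for t
    by (rule derivative_eq_intros A[OF that] refl)+
       (use Apos[OF that] in \<open>simp_all add: field_simps power2_eq_square\<close>)
  have incr: "H s - 1 / A s \<le> H t - 1 / A t" if "1 \<le> s" "s \<le> t" for s t
  proof (rule DERIV_nonneg_imp_nondecreasing[OF \<open>s \<le> t\<close>])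
    fix u assume "s \<le> u" "u \<le> t"
    then have u: "u > 0" using that by simp
    have "((\<lambda>t. H t - 1 / A t) has_real_derivative
        sin (I u) * A' u / (A u)\<^sup>2 - (- A' u / (A u)\<^sup>2)) (at u)"
      by (rule DERIV_diff dH dinv u)+
    moreover have "sin (I u) * A' u / (A u)\<^sup>2 - (- A' u / (A u)\<^sup>2)
        = (sin (I u) + 1) * A' u / (A u)\<^sup>2"
      by (simp add: algebra_simps add_divide_distrib)
    moreover have "(sin (I u) + 1) * A' u / (A u)\<^sup>2 \<ge> 0"
      using A'nonneg[OF u] sin_ge_minus_one[of "I u"]
      by (intro divide_nonneg_nonneg mult_nonneg_nonneg zero_le_power2) linarith+
    ultimately show "\<exists>y. ((\<lambda>t. H t - 1 / A t) has_real_derivative y) (at u) \<and> 0 \<le> y"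
      by metis
  qed
  have decr: "H t + 1 / A t \<le> H s + 1 / A s" if "1 \<le> s" "s \<le> t" for s t
  proof (rule DERIV_nonpos_imp_nonincreasing[OF \<open>s \<le> t\<close>])
    fix u assume "s \<le> u" "u \<le> t"
    then have u: "u > 0" using that by simp
    have "((\<lambda>t. H t + 1 / A t) has_real_derivative
        sin (I u) * A' u / (A u)\<^sup>2 + (- A' u / (A u)\<^sup>2)) (at u)"
      by (rule DERIV_add dH dinv u)+
    moreover have "sin (I u) * A' u / (A u)\<^sup>2 + (- A' u / (A u)\<^sup>2)
        = (sin (I u) - 1) * A' u / (A u)\<^sup>2"
      by (simp add: algebra_simps diff_divide_distrib)
    moreover have "(sin (I u) - 1) * A' u / (A u)\<^sup>2 \<le> 0"
      using A'nonneg[OF u] sin_le_one[of "I u"]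
      by (intro divide_nonpos_nonneg mult_nonpos_nonneg) auto
    ultimately show "\<exists>y. ((\<lambda>t. H t + 1 / A t) has_real_derivative y) (at u) \<and> y \<le> 0"
      by metis
  qed
  \<comment> \<open>The decreasing function lies above the increasing one, so its value at 1 is an
    upper bound.\<close>
  obtain L where L: "((\<lambda>t. H t - 1 / A t) \<longlongrightarrow> L) at_top"
  proof (rule bounded_increasing_convergent_at_top)
    show "H t - 1 / A t \<le> H 1 + 1 / A 1" if "1 \<le> t" for t
    proof -
      have "1 / A t > 0" using that Apos[of t] by simp
      then show ?thesis using decr[of 1 t] that by linarith
    qed
  qed (use incr in auto)
  have inv0: "((\<lambda>t. 1 / A t) \<longlongrightarrow> 0) at_top"
    using tendsto_inverse_0_at_top[OF Alim] by (simp add: inverse_eq_divide)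
  have "((\<lambda>t. sin (I t) / A t) \<longlongrightarrow> 0) at_top"
  proof (rule tendsto_0_le[OF inv0, where K = 1])
    show "\<forall>\<^sub>F t in at_top. norm (sin (I t) / A t) \<le> norm (1 / A t) * 1"
      by (auto simp: abs_divide intro!: always_eventually divide_right_mono)
  qed
  from tendsto_add[OF tendsto_add[OF L inv0] this] have "(D \<longlongrightarrow> L) at_top"
    by (simp add: H_def)
  then have "((\<lambda>t. D t - L) \<longlongrightarrow> 0) at_top"
    by (simp add: LIM_zero_iff)
  moreover have "((\<lambda>t. D t - L) has_real_derivative cos (I t)) (at t)" if "t > 0" for t
    using DERIV_diff[OF D[OF that] DERIV_const[of L]] by simp
  ultimately show ?thesis using that by blast
qed

section \<open>Decay of stable linear systems under vanishing forcing\<close>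

text \<open>Gronwall argument with integrating factor \<open>exp (c * t)\<close>: once
  \<open>h\<close> is below \<open>c * (e / 2)\<close>, the excess of \<open>V\<close> over
  \<open>e / 2\<close> is at most an exponentially decaying term.\<close>

lemma damped_inequality_tendsto_0:
  fixes V h :: "real \<Rightarrow> real"
  assumes V: "\<And>t. t > 0 \<Longrightarrow> (V has_real_derivative V' t) (at t)"
    and V': "\<And>t. t > 0 \<Longrightarrow> V' t \<le> - c * V t + h t"
    and nonneg: "\<And>t. V t \<ge> 0" and c: "c > 0" and h: "(h \<longlongrightarrow> 0) at_top"
  shows "(V \<longlongrightarrow> 0) at_top"
proof (rule tendstoI)
  fix e :: real assume e: "e > 0"
  have "\<forall>\<^sub>F t in at_top. h t < c * (e / 2)"
    using order_tendstoD(2)[OF h, of "c * (e / 2)"] c e by simp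
  then obtain T0 where T0: "\<And>t. t \<ge> T0 \<Longrightarrow> h t < c * (e / 2)"
    by (auto simp: eventually_at_top_linorder)
  \<comment> \<open>The maximum with 1 keeps \<open>T\<close> positive, where the derivative of
    \<open>V\<close> is available.\<close>
  define T where "T = max T0 1"
  define W where "W t = exp (c * t) * (V t - e / 2)" for t
  have W: "W t \<le> W T" if "T \<le> t" for t
  proof (rule DERIV_nonpos_imp_nonincreasing[OF that])
    fix u assume "T \<le> u"
    then have u: "u > 0" "u \<ge> T0" by (auto simp: T_def)
    have "(W has_real_derivative exp (c * u) * (c * (V u - e / 2) + V' u)) (at u)"
      unfolding W_def
      by (rule derivative_eq_intros V[OF u(1)] refl)+ (simp add: algebra_simps)
    moreover have "exp (c * u) * (c * (V u - e / 2) + V' u) \<le> 0"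
      using V'[OF u(1)] T0[OF u(2)]
      by (intro mult_nonneg_nonpos) (auto simp: algebra_simps)
    ultimately show "\<exists>y. (W has_real_derivative y) (at u) \<and> y \<le> 0" by blast
  qed
  have ct: "filterlim (\<lambda>t. c * t) at_top at_top"
    using c by (intro filterlim_tendsto_pos_mult_at_top[OF tendsto_const] filterlim_ident)
  then have "((\<lambda>t. exp (- (c * t))) \<longlongrightarrow> 0) at_top"
    by (intro filterlim_compose[OF exp_at_bot]) (simp add: filterlim_uminus_at_top)
  then have "((\<lambda>t. W T * exp (- (c * t))) \<longlongrightarrow> 0) at_top"
    by (rule tendsto_mult_right_zero)
  then have "\<forall>\<^sub>F t in at_top. W T * exp (- (c * t)) < e / 2"
    using e by (intro order_tendstoD(2)) auto
  then show "\<forall>\<^sub>F t in at_top. dist (V t) 0 < e"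
    using eventually_ge_at_top[of T]
  proof eventually_elim
    case (elim t)
    have "V t - e / 2 = W t * exp (- (c * t))"
      by (simp add: W_def exp_minus field_simps)
    also have "\<dots> \<le> W T * exp (- (c * t))"
      using W[OF elim(2)] by (intro mult_right_mono) auto
    finally show ?case using elim(1) nonneg[of t] by simp
  qed
qed

text \<open>The plain energy \<open>p\<^sup>2 + b * w\<^sup>2\<close> dissipates only through
  \<open>p\<close>. Adding \<open>(p + a * w)\<^sup>2\<close> makes \<open>w\<close> dissipate as
  well, which reduces the claim to the scalar damped inequality.\<close>

lemma stable_system_tendsto_0:
  fixes w p g h :: "real \<Rightarrow> real"
  assumes a: "a > 0" and b: "b > 0"
    and w: "\<And>t. t > 0 \<Longrightarrow> (w has_real_derivative p t + g t) (at t)"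
    and p: "\<And>t. t > 0 \<Longrightarrow> (p has_real_derivative - a * p t - b * w t + h t) (at t)"
    and g: "(g \<longlongrightarrow> 0) at_top" and h: "(h \<longlongrightarrow> 0) at_top"
  shows "(w \<longlongrightarrow> 0) at_top" and "(p \<longlongrightarrow> 0) at_top"
proof -
  \<comment> \<open>Without forcing this Lyapunov function has derivative \<open>- 2 a (p\<^sup>2 + b w\<^sup>2)\<close>.\<close>
  define V where "V t = (p t + a * w t)\<^sup>2 + (p t)\<^sup>2 + 2 * b * (w t)\<^sup>2" for t
  \<comment> \<open>\<open>P\<close> and \<open>Q\<close> collect what the forcing terms
    \<open>g\<close> and \<open>h\<close> contribute to the derivative of \<open>V\<close>, as
    coefficients of \<open>2 * p\<close> and \<open>2 * w\<close>.\<close>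
  define P where "P t = a * g t + 2 * h t" for t
  define Q where "Q t = a * (a * g t + h t) + 2 * b * g t" for t
  \<comment> \<open>Chosen so that \<open>c * V\<close> is at most
    \<open>a * p\<^sup>2 + a * b * w\<^sup>2\<close>, half of the dissipation; the other half
    absorbs the cross terms with \<open>P\<close> and \<open>Q\<close>.\<close>
  define c where "c = min (a / 3) (a * b / (2 * (a\<^sup>2 + b)))"
  have c: "c > 0" using a b by (simp add: c_def add_pos_pos)
  have dV: "(V has_real_derivative
      - 2 * a * (p t)\<^sup>2 - 2 * a * b * (w t)\<^sup>2 + 2 * p t * P t + 2 * w t * Q t) (at t)"
    if "t > 0" for t
    unfolding V_def
    by (rule derivative_eq_intros w[OF that] p[OF that] refl)+
       (simp add: P_def Q_def algebra_simps power2_eq_square)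
  have "(V \<longlongrightarrow> 0) at_top"
  proof (rule damped_inequality_tendsto_0[OF dV])
    show "- 2 * a * (p t)\<^sup>2 - 2 * a * b * (w t)\<^sup>2 + 2 * p t * P t + 2 * w t * Q t
        \<le> - c * V t + ((P t)\<^sup>2 / a + (Q t)\<^sup>2 / (a * b))" for t
    proof -
      \<comment> \<open>Young's inequality, applied below with weights \<open>a\<close> and
        \<open>a * b\<close> so that exactly half of the dissipation is spent.\<close>
      have young: "2 * y * z \<le> k * y\<^sup>2 + z\<^sup>2 / k" if "k > 0" for y z k :: real
      proof -
        have "0 \<le> (k * y - z)\<^sup>2 / k" using that by simp
        also have "\<dots> = k * y\<^sup>2 + z\<^sup>2 / k - 2 * y * z"
          using that by (simp add: field_simps power2_eq_square)
        finally show ?thesis by simp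
      qed
      \<comment> \<open>The square of \<open>p - a * w\<close> is the gap in bounding
        \<open>(p + a * w)\<^sup>2\<close> by
        \<open>2 * p\<^sup>2 + 2 * a\<^sup>2 * w\<^sup>2\<close>.\<close>
      have "V t \<le> 3 * (p t)\<^sup>2 + 2 * (a\<^sup>2 + b) * (w t)\<^sup>2"
        using zero_le_power2[of "p t - a * w t"]
        by (simp add: V_def algebra_simps power2_eq_square)
      then have "c * V t \<le> c * (3 * (p t)\<^sup>2 + 2 * (a\<^sup>2 + b) * (w t)\<^sup>2)"
        using c by simp
      also have "\<dots> = (3 * c) * (p t)\<^sup>2 + (2 * (a\<^sup>2 + b) * c) * (w t)\<^sup>2"
        by (simp add: algebra_simps)
      also have "\<dots> \<le> a * (p t)\<^sup>2 + (a * b) * (w t)\<^sup>2"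
      proof -
        have "c \<le> a / 3" "c \<le> a * b / (2 * (a\<^sup>2 + b))"
          unfolding c_def by (rule min.cobounded1 min.cobounded2)+
        moreover have "2 * (a\<^sup>2 + b) > 0" using b by (simp add: add_nonneg_pos)
        ultimately have "3 * c \<le> a" "2 * (a\<^sup>2 + b) * c \<le> a * b"
          by (auto simp: pos_le_divide_eq mult.commute)
        then show ?thesis by (intro add_mono mult_right_mono) auto
      qed
      finally show ?thesis
        using young[OF a, of "p t" "P t"] young[of "a * b" "w t" "Q t"] a b by simp
    qed
    have "((\<lambda>t. (P t)\<^sup>2 / a + (Q t)\<^sup>2 / (a * b)) \<longlongrightarrow>
        (a * 0 + 2 * 0)\<^sup>2 / a + (a * (a * 0 + 0) + 2 * b * 0)\<^sup>2 / (a * b)) at_top"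
      unfolding P_def Q_def using a b by (intro tendsto_intros g h) auto
    then show "((\<lambda>t. (P t)\<^sup>2 / a + (Q t)\<^sup>2 / (a * b)) \<longlongrightarrow> 0) at_top" by simp
  qed (use b c in \<open>auto simp: V_def\<close>)
  have "((\<lambda>t. (p t)\<^sup>2) \<longlongrightarrow> 0) at_top"
    by (rule tendsto_sandwich[OF _ _ tendsto_const \<open>(V \<longlongrightarrow> 0) at_top\<close>])
       (use b in \<open>auto simp: V_def\<close>)
  then show "(p \<longlongrightarrow> 0) at_top" by (simp add: tendsto_null_power)
  have "((\<lambda>t. (w t)\<^sup>2) \<longlongrightarrow> 0) at_top"
    by (rule tendsto_sandwich[OF _ _ tendsto_const
          tendsto_divide_zero[OF \<open>(V \<longlongrightarrow> 0) at_top\<close>, of "2 * b"]])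
       (use b in \<open>auto simp: V_def field_simps\<close>)
  then show "(w \<longlongrightarrow> 0) at_top" by (simp add: tendsto_null_power)
qed

section \<open>Recurrence of phases and lower bounds for the limit superior\<close>

lemma filterlim_at_top_deriv_ge:
  fixes g g' :: "real \<Rightarrow> real"
  assumes g: "\<And>t. t \<ge> T \<Longrightarrow> (g has_real_derivative g' t) (at t)"
    and ge: "\<And>t. t \<ge> T \<Longrightarrow> g' t \<ge> c" and c: "c > 0"
  shows "filterlim g at_top at_top"
proof (rule filterlim_at_top_mono)
  show "\<forall>\<^sub>F t in at_top. (g T - c * T) + c * t \<le> g t"
    using eventually_ge_at_top[of T]
  proof eventually_elim
    case (elim t)
    have "g T - c * T \<le> g t - c * t"
    proof (rule DERIV_nonneg_imp_nondecreasing[OF elim])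
      fix u assume "T \<le> u"
      then have "((\<lambda>t. g t - c * t) has_real_derivative g' u - c) (at u)"
        by (auto intro!: derivative_eq_intros g)
      then show "\<exists>y. ((\<lambda>t. g t - c * t) has_real_derivative y) (at u) \<and> 0 \<le> y"
        using ge[OF \<open>T \<le> u\<close>] by force
    qed
    then show ?case by simp
  qed
  show "filterlim (\<lambda>t. (g T - c * T) + c * t) at_top at_top"
    using c by (intro filterlim_tendsto_add_at_top[OF tendsto_const]
        filterlim_tendsto_pos_mult_at_top[OF tendsto_const] filterlim_ident)
qed

text \<open>Beyond any \<open>T\<close>, pick a level \<open>c + 2 * pi * real n\<close> above
  \<open>g T\<close>; since \<open>g\<close> is unbounded, the intermediate value theorem gives a
  crossing after \<open>T\<close>. It supplies arbitrarily late times at which \<open>sin\<close> or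
  \<open>cos\<close> of the phase equals 1.\<close>

lemma frequently_phase_at_top:
  fixes g :: "real \<Rightarrow> real"
  assumes cont: "\<And>t. t > 0 \<Longrightarrow> isCont g t" and lim: "filterlim g at_top at_top"
  shows "\<exists>\<^sub>F t in at_top. \<exists>n. g t = c + 2 * pi * real n"
  unfolding frequently_def
proof
  assume "\<forall>\<^sub>F t in at_top. \<not> (\<exists>n. g t = c + 2 * pi * real n)"
  then obtain T0 where T0: "\<And>t n. t \<ge> T0 \<Longrightarrow> g t \<noteq> c + 2 * pi * real n"
    by (auto simp: eventually_at_top_linorder)
  define T where "T = max T0 1"
  obtain n :: nat where "(g T - c) / (2 * pi) \<le> real n" using real_arch_simple by blast
  then have n: "g T \<le> c + 2 * pi * real n" by (simp add: field_simps)
  have "\<forall>\<^sub>F t in at_top. c + 2 * pi * real n \<le> g t"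
    using lim by (simp add: filterlim_at_top)
  then have "\<forall>\<^sub>F t in at_top. c + 2 * pi * real n \<le> g t \<and> T \<le> t"
    using eventually_ge_at_top by (rule eventually_conj)
  then obtain t where t: "c + 2 * pi * real n \<le> g t" "T \<le> t"
    by (auto simp: eventually_at_top_linorder)
  have "continuous_on {T..t} g"
    using cont by (intro continuous_at_imp_continuous_on) (auto simp: T_def)
  from IVT'[OF n t(1,2) this] obtain u where "T \<le> u" "g u = c + 2 * pi * real n" by blast
  with T0[of u n] show False by (auto simp: T_def)
qed

lemma Limsup_ge_frequently:
  fixes g :: "'a \<Rightarrow> 'b :: {complete_linorder}"
  assumes "\<exists>\<^sub>F t in F. c \<le> g t"
  shows "c \<le> Limsup F g"
proof (rule ccontr)
  assume "\<not> c \<le> Limsup F g"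
  then have "\<forall>\<^sub>F t in F. g t < c" by (intro Limsup_lessD) auto
  then have "\<forall>\<^sub>F t in F. \<not> c \<le> g t" by (rule eventually_mono) auto
  with assms show False by (simp add: frequently_def)
qed

section \<open>Asymptotics of \<open>x\<close>, \<open>x'\<close> and \<open>x''\<close> for the
  forced equation\<close>

theorem proposition15:
  fixes a b \<xi>\<^sub>0 \<xi>\<^sub>1 :: real
    and A f x x' x'' :: "real \<Rightarrow> real"
  assumes "a > 0" and "b > 0"
    and "\<And>t. t \<ge> 0 \<Longrightarrow> A t > 0"
    and "strict_mono_on {0..} A"
    and "C1_halfline A"
    and "filterlim A at_top at_top"
    and "\<And>t. t \<ge> 0 \<Longrightarrow> f t = A t * sin (integral {0..t} A)"
    and "has_derivative_halfline x x'"
    and "has_derivative_halfline x' x''"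
    and "\<And>t. t \<ge> 0 \<Longrightarrow> x'' t + a * x' t + b * x t = f t"
    and "x 0 = \<xi>\<^sub>0" and "x' 0 = \<xi>\<^sub>1"
  shows "(\<lambda>t. x'' t - f t) \<in> O[at_top](\<lambda>_. 1)
    \<and> Limsup at_top (\<lambda>t. ereal \<bar>x'' t\<bar>) = \<infinity>
    \<and> 0 < Limsup at_top (\<lambda>t. ereal \<bar>x' t\<bar>)
    \<and> Limsup at_top (\<lambda>t. ereal \<bar>x' t\<bar>) < \<infinity>
    \<and> (x \<longlongrightarrow> 0) at_top"
proof -
  obtain A' where A': "has_derivative_halfline A A'"
    using assms(5) by (auto simp: C1_halfline_def)
  have dA: "(A has_real_derivative A' t) (at t)" if "t > 0" for t
    using has_derivative_halflineD[OF A' that] .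
  have A'nonneg: "A' t \<ge> 0" if "t > 0" for t
    using mono_on_imp_deriv_nonneg[OF strict_mono_on_imp_mono_on[OF assms(4)] dA[OF that]] that
    by simp
  define I where "I t = integral {0..t} A" for t
  have I: "has_derivative_halfline I A"
    unfolding I_def
    by (intro has_derivative_halfline_integral has_derivative_halfline_continuous_on[OF A'])
  note dI = has_derivative_halflineD[OF I]
  define D where "D t = integral {0..t} (\<lambda>s. cos (I s))" for t
  have "has_derivative_halfline D (\<lambda>s. cos (I s))"
    unfolding D_def
    by (intro has_derivative_halfline_integral continuous_on_cos
        has_derivative_halfline_continuous_on[OF I])
  note dD = has_derivative_halflineD[OF this]
  obtain C where dC: "\<And>t. t > 0 \<Longrightarrow> (C has_real_derivative cos (I t)) (at t)"
    and C: "(C \<longlongrightarrow> 0) at_top"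
    by (rule vanishing_primitive_cos[OF dI dA assms(3) A'nonneg assms(6) dD]) auto
  have eq: "x'' t = A t * sin (I t) - a * x' t - b * x t" if "t > 0" for t
    using assms(7,10)[of t] that by (simp add: I_def)

  \<comment> \<open>With these variables, \<open>w' = x' + cos I = p + a * C\<close>. In
    \<open>p'\<close> the derivative of \<open>cos I\<close> cancels the unbounded forcing, and the
    term \<open>- a * C\<close> turns \<open>- a * x'\<close> into
    \<open>- a * (x' + cos I)\<close>, leaving only multiples of \<open>p\<close>, \<open>w\<close>
    and \<open>C\<close>.\<close>
  define w where "w t = x t + C t" for t
  define p where "p t = x' t + cos (I t) - a * C t" for t
  have dw: "(w has_real_derivative p t + a * C t) (at t)" if "t > 0" for t
    unfolding w_def
    by (rule derivative_eq_intros has_derivative_halflineD[OF assms(8) that] dC[OF that] refl)+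
       (simp add: p_def)
  have dp: "(p has_real_derivative - a * p t - b * w t + (b - a\<^sup>2) * C t) (at t)"
    if "t > 0" for t
    unfolding p_def
    by (rule derivative_eq_intros has_derivative_halflineD[OF assms(9) that] dC[OF that]
        dI[OF that] refl)+
       (simp add: eq[OF that] p_def w_def algebra_simps power2_eq_square)
  have w0: "(w \<longlongrightarrow> 0) at_top"
    by (rule stable_system_tendsto_0(1)[OF assms(1,2) dw dp])
       (auto intro: tendsto_mult_right_zero C)
  have p0: "(p \<longlongrightarrow> 0) at_top"
    by (rule stable_system_tendsto_0(2)[OF assms(1,2) dw dp])
       (auto intro: tendsto_mult_right_zero C)
  have x0: "(x \<longlongrightarrow> 0) at_top"
    using tendsto_diff[OF w0 C] by (simp add: w_def)
  \<comment> \<open>The error in \<open>x' = - cos I + r\<close>; it equals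
    \<open>p + a * C\<close>, so it vanishes at infinity.\<close>
  define r where "r t = x' t + cos (I t)" for t
  have r0: "(r \<longlongrightarrow> 0) at_top"
    using tendsto_add[OF p0 tendsto_mult_right_zero[OF C, of a]] by (simp add: p_def r_def[abs_def])

  have x_small: "\<forall>\<^sub>F t in at_top. \<bar>x t\<bar> < 1"
    using tendstoD[OF x0, of 1] by simp
  have r_small: "\<forall>\<^sub>F t in at_top. \<bar>r t\<bar> < 1 / 2"
    using tendstoD[OF r0, of "1 / 2"] by simp
  have x'_bound: "\<forall>\<^sub>F t in at_top. \<bar>x' t\<bar> \<le> 2"
    using r_small
  proof eventually_elim
    case (elim t)
    then show ?case using abs_cos_le_one[of "I t"] unfolding r_def by linarith
  qed
  \<comment> \<open>The constant comes from the eventual bounds 2 on \<open>x'\<close> and 1 on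
    \<open>x\<close>.\<close>
  have diff_bound: "\<forall>\<^sub>F t in at_top. \<bar>x'' t - f t\<bar> \<le> 2 * a + b"
    using x_small x'_bound eventually_gt_at_top[of 0]
  proof eventually_elim
    case (elim t)
    have "x'' t - f t = - (a * x' t + b * x t)"
      using assms(10)[of t] elim by simp
    then have "\<bar>x'' t - f t\<bar> \<le> a * \<bar>x' t\<bar> + b * \<bar>x t\<bar>"
      using abs_triangle_ineq[of "a * x' t" "b * x t"] assms(1,2) by (simp add: abs_mult)
    also have "\<dots> \<le> a * 2 + b * 1"
      using elim assms(1,2) by (intro add_mono mult_left_mono) auto
    finally show ?case by simp
  qed

  have contI: "isCont I t" if "t > 0" for t
    using dI[OF that] by (rule DERIV_isCont)
  have Ilim: "filterlim I at_top at_top"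
  proof (rule filterlim_at_top_deriv_ge[where T = 1 and c = "A 1"])
    show "A t \<ge> A 1" if "t \<ge> 1" for t
      using mono_onD[OF strict_mono_on_imp_mono_on[OF assms(4)], of 1 t] that by simp
  qed (use dI assms(3) in auto)

  have "(\<lambda>t. x'' t - f t) \<in> O[at_top](\<lambda>_. 1)"
    by (rule bigoI[where c = "2 * a + b"]) (use diff_bound in simp)
  moreover have "Limsup at_top (\<lambda>t. ereal \<bar>x'' t\<bar>) = \<infinity>"
  proof (rule ereal_top)
    fix M :: real
    \<comment> \<open>At these phases the sine is 1 and \<open>f = A\<close>. Asking
      \<open>A\<close> to exceed \<open>M + (2 * a + b)\<close> leaves at least \<open>M\<close>
      after the bounded difference between \<open>x''\<close> and \<open>f\<close> is
      deducted.\<close>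
    have "\<exists>\<^sub>F t in at_top. \<exists>n. I t = pi / 2 + 2 * pi * real n"
      by (rule frequently_phase_at_top[OF contI Ilim])
    moreover have "\<forall>\<^sub>F t in at_top. M + (2 * a + b) \<le> A t"
      using assms(6) by (simp add: filterlim_at_top)
    with diff_bound eventually_gt_at_top[of 0]
    have "\<forall>\<^sub>F t in at_top.
        (\<exists>n. I t = pi / 2 + 2 * pi * real n) \<longrightarrow> ereal M \<le> ereal \<bar>x'' t\<bar>"
    proof eventually_elim
      case (elim t)
      show ?case
      proof
        assume "\<exists>n. I t = pi / 2 + 2 * pi * real n"
        then obtain n :: nat where "I t = pi / 2 + 2 * pi * real n" ..
        then have "sin (I t) = 1" using cos_2npi[of n] by (simp add: sin_add mult_ac)
        then have "f t = A t" using assms(7)[of t] elim by (simp add: I_def)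
        then show "ereal M \<le> ereal \<bar>x'' t\<bar>" using elim by simp
      qed
    qed
    ultimately have "\<exists>\<^sub>F t in at_top. ereal M \<le> ereal \<bar>x'' t\<bar>"
      by (rule frequently_rev_mp)
    then show "ereal M \<le> Limsup at_top (\<lambda>t. ereal \<bar>x'' t\<bar>)"
      by (rule Limsup_ge_frequently)
  qed
  moreover have "0 < Limsup at_top (\<lambda>t. ereal \<bar>x' t\<bar>)"
  proof -
    \<comment> \<open>At multiples of \<open>2 * pi\<close> the cosine is 1, so
      \<open>x' = r - 1\<close> has absolute value above 1/2 once \<open>r\<close> is small.\<close>
    have "\<exists>\<^sub>F t in at_top. \<exists>n. I t = 0 + 2 * pi * real n"
      by (rule frequently_phase_at_top[OF contI Ilim])
    moreover have "\<forall>\<^sub>F t in at_top.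
        (\<exists>n. I t = 0 + 2 * pi * real n) \<longrightarrow> ereal (1 / 2) \<le> ereal \<bar>x' t\<bar>"
      using r_small
    proof eventually_elim
      case (elim t)
      show ?case
      proof
        assume "\<exists>n. I t = 0 + 2 * pi * real n"
        then obtain n :: nat where "I t = 0 + 2 * pi * real n" ..
        then have "cos (I t) = 1" using cos_2npi[of n] by (simp add: mult_ac)
        then have "1 / 2 \<le> \<bar>x' t\<bar>" using elim unfolding r_def by linarith
        then show "ereal (1 / 2) \<le> ereal \<bar>x' t\<bar>" by simp
      qed
    qed
    ultimately have "\<exists>\<^sub>F t in at_top. ereal (1 / 2) \<le> ereal \<bar>x' t\<bar>"
      by (rule frequently_rev_mp)
    then have "ereal (1 / 2) \<le> Limsup at_top (\<lambda>t. ereal \<bar>x' t\<bar>)"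
      by (rule Limsup_ge_frequently)
    then show ?thesis by (rule less_le_trans[rotated]) simp
  qed
  moreover have "Limsup at_top (\<lambda>t. ereal \<bar>x' t\<bar>) < \<infinity>"
  proof -
    have "Limsup at_top (\<lambda>t. ereal \<bar>x' t\<bar>) \<le> ereal 2"
      by (rule Limsup_bounded) (use x'_bound in simp)
    then show ?thesis by (rule le_less_trans) simp
  qed
  ultimately show ?thesis using x0 by blast
qed

end
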